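(* Let $f: \mathbb{R}^n \to \mathbb{R}$ be convex. Let $x_0 \in \mathbb{R}^n$, $r > 0$, $\lambda\in (0,1)$, and $\alpha > \max \left\{ 1, \dfrac{\lambda}{1-\lambda}\right\}$. Let $S \subset \mathbb{R}^n$ be a finite set of points such that $B(x_0,\alpha r) \subset \operatorname{conv}(S)$. Then $f$ is Lipschitz continuous on $B(x_0,r)$ with constant $$L(\lambda,\alpha,r) = \dfrac{1}{r\lambda (\alpha - 1)}\cdot\left[\max \{ f(z) \mid z \in S \} - f(x_0)\right].$$
   Context: $\mathbb{R}^n$ ($n$ a positive integer) is the standard Euclidean space with Euclidean norm $\|\cdot\|$. $B(x_0,\rho)$ denotes the open ball with center $x_0\in\mathbb{R}^n$ and radius $\rho>0$. $\operatorname{conv}(S)$ is the convex hull of $S$. A function $f:\mathbb{R}^n\to\mathbb{R}$ is convex if $f(\lambda x+(1-\lambda)y)\le \lambda f(x)+(1-\lambda)f(y)$ for all $x,y\in\mathbb{R}^n$ and all $\lambda\in[0,1]$. A function $f$ is Lipschitz continuous on a set $D\subset\mathbb{R}^n$ with constant $L\ge 0$ if $|f(x)-f(y)|\le L\|x-y\|$ for all $x,y\in D$. *)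

theory Defs
  imports "HOL-Analysis.Analysis"
begin

end

theory Submission
  imports Defs
begin

text \<open>
  A convex function bounded above by \<open>M\<close> on a ball is Lipschitz on every smaller concentric ball:
  prolonging the segment from \<open>x\<close> to \<open>y\<close> by the width \<open>s\<close> of the collar between the two balls
  stays inside the large ball, where \<open>f \<le> M\<close>, so monotonicity of slopes bounds the slope on
  \<open>[x, y]\<close> by \<open>(M - f x) / s\<close> (lemma \<open>convex_on_slope_le_of_bounded_above\<close>).

  This bound still depends on \<open>f x\<close>, which has to be replaced by the value at the centre. Since
  the centre lies between \<open>x\<close> and the point \<open>x\<^sub>0 - \<alpha> (x - x\<^sub>0)\<close> of the large ball, convexity
  limits how far \<open>f\<close> can drop at \<open>x\<close>: the depth \<open>M - f x\<close> is at most \<open>(1 + \<alpha>) / \<alpha>\<close> times the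
  depth at the centre (lemma \<open>convex_on_depth_le_center_depth\<close>). The condition
  \<open>\<alpha> > lam / (1 - lam)\<close> says exactly that \<open>(1 + \<alpha>) / \<alpha> < 1 / lam\<close>, which yields the factor
  \<open>1 / lam\<close> in the constant. Finally, \<open>M\<close> may be taken to be the maximum of \<open>f\<close> on \<open>S\<close>, because a
  convex function is bounded on a convex hull by its values at the generating points.
\<close>

lemma convex_on_slope_le_of_bounded_above:
  fixes f :: "'a::real_normed_vector \<Rightarrow> real"
  assumes conv: "convex_on (ball c (r + s)) f"
    and bound: "\<And>z. z \<in> ball c (r + s) \<Longrightarrow> f z \<le> M"
    and s: "s > 0" and x: "x \<in> ball c r" and y: "y \<in> ball c r"
  shows "f y - f x \<le> (M - f x) / s * dist x y"
proof (cases "x = y")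
  case False
  define d where "d = norm (y - x)"
  have d: "d > 0" using False by (simp add: d_def)
  \<comment> \<open>Overshoot \<open>y\<close> by exactly \<open>s\<close>; then \<open>y\<close> divides \<open>[x, z]\<close> in the ratio \<open>d : s\<close>.\<close>
  define z where "z = y + (s / d) *\<^sub>R (y - x)"
  define t where "t = d / (d + s)"
  have t: "0 \<le> t" "t \<le> 1" and t_le: "t \<le> d / s"
    using d s by (simp_all add: t_def frac_le)
  have "norm ((s / d) *\<^sub>R (y - x)) = s" using d s by (simp add: d_def)
  then have z: "z \<in> ball c (r + s)"
    using y norm_triangle_ineq4[of "c - y" "(s / d) *\<^sub>R (y - x)"]
    by (simp add: z_def dist_norm diff_diff_eq)
  have x': "x \<in> ball c (r + s)" using x s by simp
  have "1 + s / d = (d + s) / d" using d by (simp add: add_divide_distrib)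
  then have ratio: "t * (1 + s / d) = 1" using d s by (simp add: t_def)
  have "(1 - t) *\<^sub>R x + t *\<^sub>R z = x + (t * (1 + s / d)) *\<^sub>R (y - x)"
    by (simp add: z_def algebra_simps)
  then have "(1 - t) *\<^sub>R x + t *\<^sub>R z = y" by (simp add: ratio)
  then have "f y \<le> (1 - t) * f x + t * f z"
    using convex_onD[OF conv t x' z] by simp
  also have "\<dots> \<le> (1 - t) * f x + t * M"
    using bound[OF z] t by (simp add: mult_left_mono)
  finally have "f y - f x \<le> t * (M - f x)" by (simp add: algebra_simps)
  also have "\<dots> \<le> d / s * (M - f x)"
    using t_le bound[OF x'] by (intro mult_right_mono) auto
  finally show ?thesis by (simp add: d_def dist_norm norm_minus_commute mult.commute)
qed simp

text \<open>
  The centre is the convex combination of \<open>x\<close> and \<open>c - a (x - c)\<close> with weights in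
  the ratio \<open>a : 1\<close>, so it inherits the fraction \<open>a / (1 + a)\<close> of the depth at \<open>x\<close>.
\<close>

lemma convex_on_depth_le_center_depth:
  fixes f :: "'a::real_normed_vector \<Rightarrow> real"
  assumes conv: "convex_on (ball c (a * r)) f"
    and bound: "\<And>z. z \<in> ball c (a * r) \<Longrightarrow> f z \<le> M"
    and a: "a \<ge> 1" and x: "x \<in> ball c r"
  shows "a / (1 + a) * (M - f x) \<le> M - f c"
proof -
  define z where "z = c - a *\<^sub>R (x - c)"
  define t where "t = 1 / (1 + a)"
  have t: "0 \<le> t" "t \<le> 1" and t': "1 - t = a / (1 + a)"
    using a by (simp_all add: t_def field_simps)
  have xr: "norm (x - c) < r" using x by (simp add: dist_norm norm_minus_commute)
  then have z: "z \<in> ball c (a * r)" using a by (simp add: z_def dist_norm)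
  have "r > 0" using xr norm_ge_zero[of "x - c"] by linarith
  then have "r \<le> a * r" using a by simp
  then have x': "x \<in> ball c (a * r)" using x by simp
  have weights: "t * (1 + a) = 1" using a by (simp add: t_def)
  have "(1 - t) *\<^sub>R x + t *\<^sub>R z = x - (t * (1 + a)) *\<^sub>R (x - c)"
    by (simp add: z_def algebra_simps)
  then have "(1 - t) *\<^sub>R x + t *\<^sub>R z = c" by (simp add: weights)
  then have "f c \<le> (1 - t) * f x + t * f z"
    using convex_onD[OF conv t x' z] by simp
  also have "\<dots> \<le> (1 - t) * f x + t * M"
    using bound[OF z] t by (simp add: mult_left_mono)
  finally have "(1 - t) * (M - f x) \<le> M - f c" by (simp add: algebra_simps)
  then show ?thesis by (simp only: t')
qed

theorem lemma1:
  fixes f :: "real ^ 'n \<Rightarrow> real"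
    and x\<^sub>0 :: "real ^ 'n"
    and r lam \<alpha> :: real
    and S :: "(real ^ 'n) set"
  assumes "convex_on UNIV f"
    and "r > 0"
    and "lam \<in> {0<..<1}"
    and "\<alpha> > max 1 (lam / (1 - lam))"
    and "finite S"
    and "ball x\<^sub>0 (\<alpha> * r) \<subseteq> convex hull S"
  shows "(1 / (r * lam * (\<alpha> - 1)) * (Max {f z | z. z \<in> S} - f x\<^sub>0))-lipschitz_on (ball x\<^sub>0 r) f"
proof -
  define M where "M = Max {f z | z. z \<in> S}"
  define s where "s = (\<alpha> - 1) * r"
  define L where "L = 1 / (r * lam * (\<alpha> - 1)) * (M - f x\<^sub>0)"
  have lam: "0 < lam" "lam < 1" and \<alpha>: "\<alpha> > 1" using assms(3,4) by auto
  have s: "s > 0" and radius: "r + s = \<alpha> * r"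
    using \<alpha> assms(2) by (simp_all add: s_def algebra_simps)
  have lam_le: "lam \<le> \<alpha> / (1 + \<alpha>)"
    using assms(4) lam \<alpha> by (simp add: field_simps)
  have conv: "convex_on (ball x\<^sub>0 (\<alpha> * r)) f"
    using convex_on_subset[OF assms(1)] by simp
  have "\<forall>z\<in>S. f z \<le> M"
    using assms(5) by (auto simp: M_def setcompr_eq_image)
  then have "\<forall>z\<in>convex hull S. f z \<le> M"
    using convex_on_convex_hull_bound convex_on_subset[OF assms(1)]
    by (metis convex_convex_hull subset_UNIV)
  then have bound: "f z \<le> M" if "z \<in> ball x\<^sub>0 (\<alpha> * r)" for z
    using that assms(6) by blast
  have one_sided: "f y - f x \<le> L * dist x y"
    if x: "x \<in> ball x\<^sub>0 r" and y: "y \<in> ball x\<^sub>0 r" for x y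
  proof -
    have "x \<in> ball x\<^sub>0 (\<alpha> * r)" using x s radius by simp
    then have "lam * (M - f x) \<le> \<alpha> / (1 + \<alpha>) * (M - f x)"
      using lam_le bound by (intro mult_right_mono) auto
    also have "\<dots> \<le> M - f x\<^sub>0"
      using convex_on_depth_le_center_depth[OF conv bound _ x] \<alpha> by simp
    finally have "M - f x \<le> (M - f x\<^sub>0) / lam" using lam by (simp add: field_simps)
    then have "(M - f x) / s \<le> (M - f x\<^sub>0) / lam / s" using s by (intro divide_right_mono) auto
    also have "\<dots> = L" by (simp add: L_def s_def mult_ac)
    finally have slope: "(M - f x) / s \<le> L" .
    have "f y - f x \<le> (M - f x) / s * dist x y"
      using convex_on_slope_le_of_bounded_above[of x\<^sub>0 r s f M x y] conv bound s x y
      by (simp add: radius)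
    also have "\<dots> \<le> L * dist x y" using slope by (intro mult_right_mono) auto
    finally show ?thesis .
  qed
  have "L-lipschitz_on (ball x\<^sub>0 r) f"
  proof (rule lipschitz_onI)
    fix x y assume "x \<in> ball x\<^sub>0 r" "y \<in> ball x\<^sub>0 r"
    then show "dist (f x) (f y) \<le> L * dist x y"
      using one_sided[of x y] one_sided[of y x] by (simp add: dist_real_def dist_commute abs_le_iff)
  next
    have "f x\<^sub>0 \<le> M" using bound assms(2) \<alpha> by simp
    then show "0 \<le> L" using lam \<alpha> assms(2) by (simp add: L_def)
  qed
  then show ?thesis by (simp add: L_def M_def)
qed

end
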